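(* Let $(\mathbb{H}^3,g)$ be the hyperbolic $3$-space of constant sectional curvature $-1$ (a complete, non-compact Riemannian manifold with constant scalar curvature $R=-6$, not isometric to Euclidean space $\mathbb{R}^3$). There exist smooth functions $f,\lambda,\mu:\mathbb{H}^3\to\mathbb{R}$ such that $$\mathrm{Ric}+\mathrm{Hess} f-\mu\, df\otimes df=\lambda g$$ on $\mathbb{H}^3$, with $\lambda>0$ everywhere and $\mu$ not constant.
   Context: $\mathrm{Ric}$ is the Ricci tensor of $g$ and $\mathrm{Hess} f=\nabla df$ is the Hessian of $f$. *)

theory Defs
  imports "HOL-Analysis.Analysis"
begin

section \<open>Smooth functions on open subsets of Euclidean space\<close>

definition partial_deriv :: "'n::finite \<Rightarrow> (real^'n \<Rightarrow> real) \<Rightarrow> real^'n \<Rightarrow> real"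
  where "partial_deriv i f x = frechet_derivative f (at x) (axis i 1)"

text \<open>The predicates below are meant for open \<open>U\<close>; then they depend only on the restriction
  of \<open>f\<close> to \<open>U\<close>.\<close>

fun Ck_on :: "nat \<Rightarrow> (real^'n::finite) set \<Rightarrow> (real^'n \<Rightarrow> real) \<Rightarrow> bool" where
  "Ck_on 0 U f \<longleftrightarrow> continuous_on U f"
| "Ck_on (Suc k) U f \<longleftrightarrow> (\<forall>x\<in>U. f differentiable (at x)) \<and> (\<forall>i. Ck_on k U (partial_deriv i f))"

definition smooth_on :: "(real^'n::finite) set \<Rightarrow> (real^'n \<Rightarrow> real) \<Rightarrow> bool"
  where "smooth_on U f \<longleftrightarrow> (\<forall>k. Ck_on k U f)"


section \<open>Riemannian geometry in a global chart\<close>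

text \<open>A metric on an open \<open>U \<subseteq> \<real>\<^sup>n\<close> is given by its Gram matrices \<open>g x $ i $ j\<close> with respect to
  the coordinate fields \<open>\<partial>\<^sub>i\<close>; all covariant 2-tensors are represented the same way.\<close>

definition riemannian_metric_on ::
    "(real^'n::finite) set \<Rightarrow> (real^'n \<Rightarrow> real^'n^'n) \<Rightarrow> bool"
  where "riemannian_metric_on U g \<longleftrightarrow> open U \<and>
    (\<forall>i j. smooth_on U (\<lambda>x. g x $ i $ j)) \<and>
    (\<forall>x\<in>U. transpose (g x) = g x \<and> (\<forall>v. v \<noteq> 0 \<longrightarrow> v \<bullet> (g x *v v) > 0))"

text \<open>\<open>christoffel g k i j\<close> is \<open>\<Gamma>\<^sup>k\<^sub>i\<^sub>j\<close>, that is, \<open>\<nabla>\<^bsub>\<partial>\<^sub>i\<^esub> \<partial>\<^sub>j = \<Sum>k. \<Gamma>\<^sup>k\<^sub>i\<^sub>j \<partial>\<^sub>k\<close>.\<close>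

definition christoffel ::
    "(real^'n::finite \<Rightarrow> real^'n^'n) \<Rightarrow> 'n \<Rightarrow> 'n \<Rightarrow> 'n \<Rightarrow> real^'n \<Rightarrow> real"
  where "christoffel g k i j x = (1/2) * (\<Sum>l\<in>UNIV. matrix_inv (g x) $ k $ l *
    (partial_deriv i (\<lambda>y. g y $ j $ l) x + partial_deriv j (\<lambda>y. g y $ i $ l) x
      - partial_deriv l (\<lambda>y. g y $ i $ j) x))"

text \<open>\<open>riemann g l i j k\<close> is the \<open>\<partial>\<^sub>l\<close>-component of \<open>R(\<partial>\<^sub>i, \<partial>\<^sub>j)\<partial>\<^sub>k\<close>, with the convention
  \<open>R(X, Y)Z = \<nabla>\<^sub>X \<nabla>\<^sub>Y Z - \<nabla>\<^sub>Y \<nabla>\<^sub>X Z - \<nabla>\<^bsub>[X,Y]\<^esub> Z\<close>.\<close>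

definition riemann ::
    "(real^'n::finite \<Rightarrow> real^'n^'n) \<Rightarrow> 'n \<Rightarrow> 'n \<Rightarrow> 'n \<Rightarrow> 'n \<Rightarrow> real^'n \<Rightarrow> real"
  where "riemann g l i j k x =
    partial_deriv i (christoffel g l j k) x - partial_deriv j (christoffel g l i k) x
    + (\<Sum>m\<in>UNIV. christoffel g l i m x * christoffel g m j k x
                 - christoffel g l j m x * christoffel g m i k x)"

text \<open>\<open>g(R(v, w)w, v) / (g(v, v) g(w, w) - g(v, w)\<^sup>2)\<close>; meaningful for linearly independent
  \<open>v\<close>, \<open>w\<close>.\<close>

definition sectional_curvature ::
    "(real^'n::finite \<Rightarrow> real^'n^'n) \<Rightarrow> real^'n \<Rightarrow> real^'n \<Rightarrow> real^'n \<Rightarrow> real"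
  where "sectional_curvature g x v w =
    (\<Sum>l\<in>UNIV. \<Sum>p\<in>UNIV. \<Sum>i\<in>UNIV. \<Sum>j\<in>UNIV. \<Sum>k\<in>UNIV.
        g x $ l $ p * riemann g l i j k x * v $ i * w $ j * w $ k * v $ p) /
    ((v \<bullet> (g x *v v)) * (w \<bullet> (g x *v w)) - (v \<bullet> (g x *v w))\<^sup>2)"

text \<open>\<open>Ric(Y, Z)\<close> is the trace of \<open>X \<mapsto> R(X, Y)Z\<close>, hence positive on round spheres.\<close>

definition ricci :: "(real^'n::finite \<Rightarrow> real^'n^'n) \<Rightarrow> real^'n \<Rightarrow> real^'n^'n"
  where "ricci g x = (\<chi> j k. \<Sum>i\<in>UNIV. riemann g i i j k x)"

definition scalar_curvature :: "(real^'n::finite \<Rightarrow> real^'n^'n) \<Rightarrow> real^'n \<Rightarrow> real"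
  where "scalar_curvature g x =
    (\<Sum>i\<in>UNIV. \<Sum>j\<in>UNIV. matrix_inv (g x) $ i $ j * ricci g x $ i $ j)"

definition differential :: "(real^'n::finite \<Rightarrow> real) \<Rightarrow> real^'n \<Rightarrow> real^'n"
  where "differential f x = (\<chi> i. partial_deriv i f x)"

definition tensor_product :: "real^'n::finite \<Rightarrow> real^'n \<Rightarrow> real^'n^'n"
  where "tensor_product \<alpha> \<beta> = (\<chi> i j. \<alpha> $ i * \<beta> $ j)"

text \<open>Components of the covariant derivative of the 1-form \<open>\<alpha>\<close>:
  \<open>(\<nabla>\<alpha>)(\<partial>\<^sub>i, \<partial>\<^sub>j) = (\<nabla>\<^bsub>\<partial>\<^sub>i\<^esub> \<alpha>)(\<partial>\<^sub>j)\<close>.\<close>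

definition covariant_deriv ::
    "(real^'n::finite \<Rightarrow> real^'n^'n) \<Rightarrow> (real^'n \<Rightarrow> real^'n) \<Rightarrow> real^'n \<Rightarrow> real^'n^'n"
  where "covariant_deriv g \<alpha> x =
    (\<chi> i j. partial_deriv i (\<lambda>y. \<alpha> y $ j) x - (\<Sum>k\<in>UNIV. christoffel g k i j x * \<alpha> x $ k))"

definition hessian ::
    "(real^'n::finite \<Rightarrow> real^'n^'n) \<Rightarrow> (real^'n \<Rightarrow> real) \<Rightarrow> real^'n \<Rightarrow> real^'n^'n"
  where "hessian g f = covariant_deriv g (differential f)"


section \<open>Hyperbolic 3-space\<close>

text \<open>Upper half-space model: \<open>{x\<^sub>3 > 0}\<close> with \<open>g = (dx\<^sub>1\<^sup>2 + dx\<^sub>2\<^sup>2 + dx\<^sub>3\<^sup>2) / x\<^sub>3\<^sup>2\<close>.\<close>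

definition hyp3 :: "(real^3) set"
  where "hyp3 = {x. x $ 3 > 0}"

definition hyp3_metric :: "real^3 \<Rightarrow> real^3^3"
  where "hyp3_metric x = (1 / (x $ 3)\<^sup>2) *\<^sub>R mat 1"


subsection \<open>The model has constant sectional curvature -1\<close>

lemma partial_deriv_eqI:
  "(f has_derivative f') (at x) \<Longrightarrow> partial_deriv i f x = f' (axis i 1)"
  unfolding partial_deriv_def using frechet_derivative_at by metis

lemma open_hyp3: "open hyp3"
  unfolding hyp3_def by (intro open_Collect_less continuous_intros)

lemma partial_deriv_cong:
  assumes "open U" "x \<in> U" "\<And>y. y \<in> U \<Longrightarrow> f y = h y"
  shows "partial_deriv i f x = partial_deriv i h x"
proof -
  have "(f has_derivative D) (at x) \<longleftrightarrow> (h has_derivative D) (at x)" for D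
    using has_derivative_transform_within_open[of f D x UNIV U h]
      has_derivative_transform_within_open[of h D x UNIV U f] assms by auto
  then show ?thesis
    unfolding partial_deriv_def frechet_derivative_def by simp
qed

lemma Ck_on_cong:
  assumes "open U" "\<And>x. x \<in> U \<Longrightarrow> f x = h x"
  shows "Ck_on k U f \<longleftrightarrow> Ck_on k U h"
  using assms(2)
proof (induction k arbitrary: f h)
  case 0
  then show ?case by (simp cong: continuous_on_cong)
next
  case (Suc k)
  have "f differentiable (at x) \<longleftrightarrow> h differentiable (at x)" if "x \<in> U" for x
    unfolding differentiable_def
    using has_derivative_transform_within_open[of f _ x UNIV U h]
      has_derivative_transform_within_open[of h _ x UNIV U f] assms(1) that Suc.prems
    by metis
  moreover have "Ck_on k U (partial_deriv i f) \<longleftrightarrow> Ck_on k U (partial_deriv i h)" for i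
    using Suc.prems by (intro Suc.IH partial_deriv_cong[OF assms(1)]) auto
  ultimately show ?case by auto
qed

lemma partial_deriv_height_power:
  assumes "x \<in> hyp3"
  shows "partial_deriv i (\<lambda>y. c / (y $ 3) ^ n) x
    = (if i = 3 then - (real n * c) / (x $ 3) ^ Suc n else 0)"
proof -
  have nz: "x $ 3 \<noteq> 0" using assms by (simp add: hyp3_def)
  have "((\<lambda>t. c / t ^ n) has_real_derivative - (real n * c) / (x $ 3) ^ Suc n) (at (x $ 3))"
  proof -
    have "((\<lambda>t. c / t ^ n) has_real_derivative
        (0 * (x $ 3) ^ n - c * (real n * (x $ 3) ^ (n - Suc 0))) / ((x $ 3) ^ n * (x $ 3) ^ n))
        (at (x $ 3))"
      using nz by (intro DERIV_divide DERIV_const DERIV_pow) auto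
    moreover have "(0 * (x $ 3) ^ n - c * (real n * (x $ 3) ^ (n - Suc 0)))
        / ((x $ 3) ^ n * (x $ 3) ^ n) = - (real n * c) / (x $ 3) ^ Suc n"
      using nz by (cases n) (simp_all add: field_simps)
    ultimately show ?thesis by simp
  qed
  then have "((\<lambda>t. c / t ^ n) has_derivative (\<lambda>h. (- (real n * c) / (x $ 3) ^ Suc n) * h))
      (at (x $ 3))"
    unfolding has_field_derivative_def .
  moreover have "((\<lambda>y::real^3. y $ 3) has_derivative (\<lambda>h. h $ 3)) (at x)"
    by (intro bounded_linear_imp_has_derivative bounded_linear_vec_nth)
  ultimately have "((\<lambda>y. c / (y $ 3) ^ n) has_derivative
      (\<lambda>h. (- (real n * c) / (x $ 3) ^ Suc n) * h $ 3)) (at x)"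
    by (rule has_derivative_compose[rotated, where g = "\<lambda>t. c / t ^ n"])
  from partial_deriv_eqI[OF this, of i] show ?thesis
    by (auto simp: axis_def)
qed

lemma Ck_on_height_power: "Ck_on k hyp3 (\<lambda>y. c / (y $ 3) ^ n)"
proof (induction k arbitrary: c n)
  case 0
  show ?case by (auto intro!: continuous_intros simp: hyp3_def)
next
  case (Suc k)
  have "Ck_on k hyp3 (partial_deriv i (\<lambda>y. c / (y $ 3) ^ n))" for i
  proof -
    have "Ck_on k hyp3 (\<lambda>y. (if i = 3 then - (real n * c) else 0) / (y $ 3) ^ Suc n)"
      by (rule Suc.IH)
    also have "?this \<longleftrightarrow> ?thesis"
      by (intro Ck_on_cong open_hyp3) (simp add: partial_deriv_height_power)
    finally show ?thesis .
  qed
  moreover have "(\<lambda>y. c / (y $ 3) ^ n) differentiable (at x)" if "x \<in> hyp3" for x :: "real^3"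
    using that by (auto intro!: derivative_intros simp: hyp3_def bounded_linear_vec_nth
        intro: bounded_linear_imp_differentiable)
  ultimately show ?case by simp
qed

lemma hyp3_metric_component:
  "hyp3_metric x $ i $ j = (if i = j then 1 else 0) / (x $ 3) ^ 2"
  by (simp add: hyp3_metric_def mat_def)

lemma riemannian_metric_hyp3: "riemannian_metric_on hyp3 hyp3_metric"
  unfolding riemannian_metric_on_def smooth_on_def
proof (intro conjI allI ballI impI)
  show "open hyp3" by (rule open_hyp3)
  show "Ck_on k hyp3 (\<lambda>x. hyp3_metric x $ i $ j)" for k i j
    unfolding hyp3_metric_component by (rule Ck_on_height_power)
  show "transpose (hyp3_metric x) = hyp3_metric x" for x
    by (simp add: hyp3_metric_def transpose_def vec_eq_iff mat_def)
  show "v \<bullet> (hyp3_metric x *v v) > 0" if "x \<in> hyp3" "v \<noteq> 0" for x v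
    using that by (simp add: hyp3_metric_def hyp3_def scaleR_matrix_vector_assoc [symmetric])
qed

lemma matrix_inv_hyp3:
  assumes "x \<in> hyp3"
  shows "matrix_inv (hyp3_metric x) = (x $ 3)\<^sup>2 *\<^sub>R mat 1"
proof -
  have nz: "x $ 3 \<noteq> 0" using assms by (simp add: hyp3_def)
  let ?B = "(x $ 3)\<^sup>2 *\<^sub>R mat 1 :: real^3^3"
  have B: "hyp3_metric x ** ?B = mat 1 \<and> ?B ** hyp3_metric x = mat 1"
    using nz by (simp add: hyp3_metric_def matrix_scalar_ac flip: scalar_matrix_assoc)
  then have "hyp3_metric x ** matrix_inv (hyp3_metric x) = mat 1"
    unfolding matrix_inv_def by (rule someI2) simp
  then have "?B ** (hyp3_metric x ** matrix_inv (hyp3_metric x)) = ?B"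
    by simp
  then show ?thesis using B by (simp add: matrix_mul_assoc)
qed

lemma christoffel_hyp3:
  assumes "x \<in> hyp3"
  shows "christoffel hyp3_metric k i j x =
    ((if i = j \<and> k = 3 then 1 else 0) - (if i = 3 \<and> j = k then 1 else 0)
      - (if j = 3 \<and> i = k then 1 else 0)) / (x $ 3) ^ 1"
proof -
  have nz: "x $ 3 \<noteq> 0" using assms by (simp add: hyp3_def)
  have "christoffel hyp3_metric k i j x = (1/2) * (x $ 3)\<^sup>2 *
    (partial_deriv i (\<lambda>y. hyp3_metric y $ j $ k) x + partial_deriv j (\<lambda>y. hyp3_metric y $ i $ k) x
      - partial_deriv k (\<lambda>y. hyp3_metric y $ i $ j) x)"
    unfolding christoffel_def matrix_inv_hyp3[OF assms]
    by (simp add: mat_def if_distrib [of "\<lambda>a. _ * a"] if_distrib [of "\<lambda>a. a * _"] cong: if_cong)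
  moreover have "partial_deriv m (\<lambda>y. hyp3_metric y $ a $ b) x
      = - 2 * (if a = b \<and> m = 3 then 1 else 0) / ((x $ 3)\<^sup>2 * (x $ 3))" for m a b
    unfolding hyp3_metric_component partial_deriv_height_power[OF assms]
    by (simp add: power2_eq_square power3_eq_cube)
  ultimately have "christoffel hyp3_metric k i j x = (1/2) * (x $ 3)\<^sup>2 *
    (- 2 * (if j = k \<and> i = 3 then 1 else 0) / ((x $ 3)\<^sup>2 * (x $ 3))
      + - 2 * (if i = k \<and> j = 3 then 1 else 0) / ((x $ 3)\<^sup>2 * (x $ 3))
      - - 2 * (if i = j \<and> k = 3 then 1 else 0) / ((x $ 3)\<^sup>2 * (x $ 3)))"
    by presburger
  moreover have "(1/2) * y\<^sup>2 * (- 2 * p / (y\<^sup>2 * y) + - 2 * q / (y\<^sup>2 * y) - - 2 * r / (y\<^sup>2 * y))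
      = (r - p - q) / y ^ 1" if "y \<noteq> 0" for y p q r :: real
    using that by (simp add: field_simps)
  ultimately show ?thesis
    using nz by (simp only: conj_commute not_False_eq_True)
qed

lemma riemann_hyp3:
  assumes "x \<in> hyp3"
  shows "riemann hyp3_metric l i j k x =
    (if j = l then hyp3_metric x $ i $ k else 0) - (if i = l then hyp3_metric x $ j $ k else 0)"
proof -
  have nz: "x $ 3 \<noteq> 0" using assms by (simp add: hyp3_def)
  have d: "partial_deriv a (christoffel hyp3_metric b c d) x =
     (if a = 3 then - ((if c = d \<and> b = 3 then 1 else 0) - (if c = 3 \<and> d = b then 1 else 0)
      - (if d = 3 \<and> c = b then 1 else 0)) / (x $ 3) ^ 2 else 0)" for a b c d
    by (subst partial_deriv_cong[OF open_hyp3 assms christoffel_hyp3], assumption,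
      subst partial_deriv_height_power[OF assms]) (simp add: numeral_2_eq_2)
  have "\<forall>l i j k. riemann hyp3_metric l i j k x =
    (if j = l then hyp3_metric x $ i $ k else 0) - (if i = l then hyp3_metric x $ j $ k else 0)"
    unfolding riemann_def d christoffel_hyp3[OF assms] hyp3_metric_component forall_3 sum_3
    using nz by (simp add: field_simps power2_eq_square)
  then show ?thesis by blast
qed

lemma sectional_curvature_hyp3:
  assumes "x \<in> hyp3" "independent {v, w}" "v \<noteq> w"
  shows "sectional_curvature hyp3_metric x v w = -1"
proof -
  have pos: "x $ 3 > 0" using assms by (simp add: hyp3_def)
  define t where "t = 1 / (x $ 3)\<^sup>2"
  have t: "t > 0" using pos by (simp add: t_def)
  define D where "D = (v \<bullet> v) * (w \<bullet> w) - (v \<bullet> w)\<^sup>2"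
  have "D \<noteq> 0"
  proof
    assume "D = 0"
    then have "\<bar>v \<bullet> w\<bar> = norm v * norm w"
      by (smt (verit) D_def norm_ge_zero power2_norm_eq_inner power_mult_distrib
          real_sqrt_abs real_sqrt_unique zero_le_mult_iff)
    then have "collinear {0, v, w}" by (simp add: norm_cauchy_schwarz_equal)
    then have "v = 0 \<or> w = 0 \<or> (\<exists>c. w = c *\<^sub>R v)" by (simp add: collinear_lemma)
    moreover have "v \<noteq> 0" "w \<noteq> 0" using assms(2) dependent_zero by blast+
    moreover have "w \<notin> span {v}"
      using assms(2,3) independent_insert[of w "{v}"] by (simp add: insert_commute)
    ultimately show False by (auto simp: span_singleton)
  qed
  have g: "hyp3_metric x $ i $ j = (if i = j then t else 0)" for i j
    by (simp add: hyp3_metric_component t_def)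
  have ip: "a \<bullet> (hyp3_metric x *v b) = t * (a \<bullet> b)" for a b
    by (simp add: hyp3_metric_def t_def scaleR_matrix_vector_assoc [symmetric])
  have num: "(\<Sum>l\<in>UNIV. \<Sum>p\<in>UNIV. \<Sum>i\<in>UNIV. \<Sum>j\<in>UNIV. \<Sum>k\<in>UNIV.
        hyp3_metric x $ l $ p * riemann hyp3_metric l i j k x * v $ i * w $ j * w $ k * v $ p)
      = - (t\<^sup>2 * D)"
    unfolding riemann_hyp3[OF assms(1)] g sum_3 D_def inner_vec_def
    by (simp add: algebra_simps power2_eq_square)
  have "sectional_curvature hyp3_metric x v w = - (t\<^sup>2 * D) / (t\<^sup>2 * D)"
    unfolding sectional_curvature_def num ip by (simp add: D_def algebra_simps power2_eq_square)
  then show ?thesis using t \<open>D \<noteq> 0\<close> by simp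
qed

lemma ricci_hyp3:
  assumes "x \<in> hyp3"
  shows "ricci hyp3_metric x = -2 *\<^sub>R hyp3_metric x"
  unfolding ricci_def vec_eq_iff forall_3 sum_3
  by (simp add: riemann_hyp3[OF assms] hyp3_metric_component)

lemma scalar_curvature_hyp3:
  assumes "x \<in> hyp3"
  shows "scalar_curvature hyp3_metric x = -6"
proof -
  have "x $ 3 \<noteq> 0" using assms by (simp add: hyp3_def)
  then show ?thesis
    unfolding scalar_curvature_def ricci_hyp3[OF assms] matrix_inv_hyp3[OF assms] sum_3
    by (simp add: hyp3_metric_component mat_def)
qed

end

theory Submission
  imports Defs
begin

text \<open>The function \<open>u = 1/x\<^sub>3\<close> satisfies \<open>Hess u = u g\<close>, so \<open>f = h(u)\<close> has
  \<open>Hess f = h'(u) u g + h''(u) du \<otimes> du\<close>. Since \<open>Ric = -2 g\<close>, the equation holds with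
  \<open>\<lambda> = h'(u) u - 2\<close> and \<open>\<mu> = h''(u)/h'(u)\<^sup>2\<close>. The choice \<open>h(u) = 3 ln u + 3 u\<close> yields
  \<open>\<lambda> = 1 + 3 u > 0\<close> and the non-constant \<open>\<mu> = -1/(3 (1 + u)\<^sup>2)\<close>.\<close>

lemma has_derivative_height:
  fixes x :: "real^3"
  assumes "(\<phi> has_real_derivative d) (at (x $ 3))"
  shows "((\<lambda>y. \<phi> (y $ 3)) has_derivative (\<lambda>h. d * h $ 3)) (at x)"
proof -
  have "((\<lambda>y::real^3. y $ 3) has_derivative (\<lambda>h. h $ 3)) (at x)"
    by (intro bounded_linear_imp_has_derivative bounded_linear_vec_nth)
  then show ?thesis
    using assms unfolding has_field_derivative_def
    by (rule has_derivative_compose[where g = \<phi>])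
qed

lemma partial_deriv_height:
  fixes x :: "real^3"
  assumes "(\<phi> has_real_derivative d) (at (x $ 3))"
  shows "partial_deriv i (\<lambda>y. \<phi> (y $ 3)) x = (if i = 3 then d else 0)"
  using partial_deriv_eqI[OF has_derivative_height[OF assms], of i] by (auto simp: axis_def)

text \<open>Reduces regularity of a function of the height to that of its ordinary derivative, so
  that a logarithm can be handled through a rational function. The zero function accounts for the
  two horizontal partial derivatives.\<close>

lemma Ck_on_Suc_height:
  assumes "\<And>t. t > 0 \<Longrightarrow> (\<phi> has_real_derivative \<phi>' t) (at t)"
    and "Ck_on k hyp3 (\<lambda>x. \<phi>' (x $ 3))" "Ck_on k hyp3 (\<lambda>_. 0)"
  shows "Ck_on (Suc k) hyp3 (\<lambda>x. \<phi> (x $ 3))"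
proof -
  have "Ck_on k hyp3 (partial_deriv i (\<lambda>x. \<phi> (x $ 3)))" for i
  proof -
    have "Ck_on k hyp3 (\<lambda>x. if i = 3 then \<phi>' (x $ 3) else 0)"
      using assms(2,3) by (cases "i = 3") simp_all
    then show ?thesis
      using partial_deriv_height[OF assms(1)]
      by (subst Ck_on_cong[OF open_hyp3]) (auto simp: hyp3_def)
  qed
  moreover have "(\<lambda>y. \<phi> (y $ 3)) differentiable (at x)" if "x \<in> hyp3" for x
    using has_derivative_height[OF assms(1)] that
    by (auto simp: differentiable_def hyp3_def)
  ultimately show ?thesis by simp
qed

lemma has_derivative_inverse_power:
  fixes t :: real
  assumes "s + t \<noteq> 0"
  shows "((\<lambda>t. c / (s + t) ^ n) has_real_derivative - (real n * c) / (s + t) ^ Suc n) (at t)"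
proof -
  have "((\<lambda>t. c / (s + t) ^ n) has_real_derivative
      (0 * (s + t) ^ n - c * (real n * (s + t) ^ (n - 1))) / ((s + t) ^ n * (s + t) ^ n)) (at t)"
    using assms by (auto intro!: derivative_eq_intros)
  \<comment> \<open>The case split is needed for the truncated \<open>n - 1\<close>: at
    \<open>n = 0\<close> the factor \<open>real n\<close> removes that term.\<close>
  moreover have "(0 * u ^ n - c * (real n * u ^ (n - 1))) / (u ^ n * u ^ n)
      = - (real n * c) / u ^ Suc n" if "u \<noteq> 0" for u :: real
    using that by (cases n) (simp_all add: field_simps)
  ultimately show ?thesis using assms by metis
qed

text \<open>Functions of this shape are closed under differentiation, and \<open>\<lambda>\<close>, \<open>\<mu>\<close> and the
  derivative of \<open>f\<close> are all of this shape.\<close>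

lemma Ck_on_height_rational:
  assumes "s \<ge> 0"
  shows "Ck_on k hyp3 (\<lambda>x. a + b / (s + x $ 3) ^ m + c / (s + x $ 3) ^ n)"
\<comment> \<open>Differentiation changes the coefficients and raises both exponents, but keeps the
  shift \<open>s\<close>. Below, \<open>s = 0\<close> serves \<open>\<phi>'\<close> and
  \<open>lam\<close>, and \<open>s = 1\<close> serves \<open>mu\<close>.\<close>
proof (induction k arbitrary: a b c m n)
  case 0
  have "s + x $ 3 \<noteq> 0" if "x \<in> hyp3" for x
    using that assms by (simp add: hyp3_def)
  then show ?case by (auto intro!: continuous_intros)
next
  case (Suc k)
  show ?case
  proof (rule Ck_on_Suc_height[where \<phi> = "\<lambda>t. a + b / (s + t) ^ m + c / (s + t) ^ n"
        and \<phi>' = "\<lambda>t. 0 + - (real m * b) / (s + t) ^ Suc m + - (real n * c) / (s + t) ^ Suc n"])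
    fix t :: real
    assume "t > 0"
    then have "s + t \<noteq> 0" using assms by simp
    then show "((\<lambda>t. a + b / (s + t) ^ m + c / (s + t) ^ n) has_real_derivative
        0 + - (real m * b) / (s + t) ^ Suc m + - (real n * c) / (s + t) ^ Suc n) (at t)"
      by (intro DERIV_add DERIV_const has_derivative_inverse_power)
  next
    show "Ck_on k hyp3 (\<lambda>x. 0 + - (real m * b) / (s + x $ 3) ^ Suc m
        + - (real n * c) / (s + x $ 3) ^ Suc n)"
      by (rule Suc.IH)
    show "Ck_on k hyp3 (\<lambda>_. 0)"
      using Suc.IH[of 0 0 0 0 0] by simp
  qed
qed

text \<open>The differential has only a third component, so only
  \<open>\<Gamma>\<^sup>3\<^sub>i\<^sub>j\<close> enters; it is -1/t for i = j = 3, 1/t for i = j <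
  3 and 0 otherwise, where t is the height. The result is split into a multiple of dt^2 and a
  multiple of the identity, hence of the metric.\<close>

lemma hessian_height:
  assumes "\<And>t. t > 0 \<Longrightarrow> (\<phi> has_real_derivative \<phi>' t) (at t)"
    and "\<And>t. t > 0 \<Longrightarrow> (\<phi>' has_real_derivative \<phi>'' t) (at t)"
    and x: "x \<in> hyp3"
  shows "hessian hyp3_metric (\<lambda>x. \<phi> (x $ 3)) x =
    (\<chi> i j. (if i = 3 \<and> j = 3 then \<phi>'' (x $ 3) + 2 * \<phi>' (x $ 3) / x $ 3 else 0)
      - (if i = j then \<phi>' (x $ 3) / x $ 3 else 0))"
proof -
  have d: "differential (\<lambda>x. \<phi> (x $ 3)) y $ j = (if j = 3 then \<phi>' (y $ 3) else 0)"
    if "y \<in> hyp3" for y j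
    using that unfolding differential_def
    by (auto intro!: partial_deriv_height[THEN trans] assms(1) simp: hyp3_def)
  have "((\<lambda>t. if j = 3 then \<phi>' t else 0) has_real_derivative
      (if j = 3 then \<phi>'' (x $ 3) else 0)) (at (x $ 3))" for j :: 3
    using assms(2) x by (simp add: hyp3_def)
  from partial_deriv_height[OF this]
  have dd: "partial_deriv i (\<lambda>y. differential (\<lambda>x. \<phi> (x $ 3)) y $ j) x
      = (if i = 3 \<and> j = 3 then \<phi>'' (x $ 3) else 0)" for i j
    by (subst partial_deriv_cong[OF open_hyp3 x d]) auto
  show ?thesis
    unfolding hessian_def covariant_deriv_def vec_eq_iff vec_lambda_beta dd d[OF x]
      christoffel_hyp3[OF x] forall_3 sum_3
    by simp
qed

theorem mainTheorem6:
  shows "\<exists>f lam mu :: real^3 \<Rightarrow> real.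
    smooth_on hyp3 f \<and> smooth_on hyp3 lam \<and> smooth_on hyp3 mu \<and>
    (\<forall>x\<in>hyp3. ricci hyp3_metric x + hessian hyp3_metric f x
        - mu x *\<^sub>R tensor_product (differential f x) (differential f x)
      = lam x *\<^sub>R hyp3_metric x) \<and>
    (\<forall>x\<in>hyp3. lam x > 0) \<and>
    \<not> mu constant_on hyp3"
proof -
  \<comment> \<open>With u = 1/t this is 3 ln u + 3 u; likewise \<open>lam\<close> and
    \<open>mu\<close> below are 1 + 3 u and -1/(3 (1 + u)^2) rewritten in t.\<close>
  define \<phi> \<phi>' \<phi>'' :: "real \<Rightarrow> real" where "\<phi> t = 3 / t - 3 * ln t"
    and "\<phi>' t = - 3 / t - 3 / t\<^sup>2" and "\<phi>'' t = 3 / t\<^sup>2 + 6 / t ^ 3" for t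
  define f lam mu :: "real^3 \<Rightarrow> real" where "f x = \<phi> (x $ 3)"
    and "lam x = 1 + 3 / x $ 3" and "mu x = - (x $ 3)\<^sup>2 / (3 * (1 + x $ 3)\<^sup>2)" for x
  have \<phi>: "(\<phi> has_real_derivative \<phi>' t) (at t)" if "t > 0" for t
    using that unfolding \<phi>_def [abs_def] \<phi>'_def
    by (auto intro!: derivative_eq_intros simp: field_simps power2_eq_square)
  have \<phi>': "(\<phi>' has_real_derivative \<phi>'' t) (at t)" if "t > 0" for t
    using that unfolding \<phi>'_def [abs_def] \<phi>''_def
    by (auto intro!: derivative_eq_intros simp: field_simps power2_eq_square power3_eq_cube)
  have "Ck_on k hyp3 f" for k
  \<comment> \<open>The logarithm is outside the rational family, but \<open>\<phi>'\<close> is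
    inside it: order 0 is plain continuity, and higher orders pass to the derivative.\<close>
  proof (cases k)
    case 0
    then show ?thesis
      unfolding f_def [abs_def] \<phi>_def by (auto intro!: continuous_intros simp: hyp3_def)
  next
    case (Suc n)
    have "Ck_on n hyp3 (\<lambda>x. \<phi>' (x $ 3))"
      using Ck_on_height_rational[of 0 n 0 "-3" 1 "-3" 2] by (simp add: \<phi>'_def)
    moreover have "Ck_on n hyp3 (\<lambda>_. 0)"
      using Ck_on_height_rational[of 0 n 0 0 0 0 0] by simp
    ultimately show ?thesis
      unfolding Suc f_def [abs_def] by (intro Ck_on_Suc_height[OF \<phi>])
  qed
  moreover have "Ck_on k hyp3 lam" for k
    using Ck_on_height_rational[of 0 k 1 3 1 0 0] by (simp add: lam_def [abs_def])
  moreover have "Ck_on k hyp3 mu" for k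
  proof -
    \<comment> \<open>Partial fractions: expand -(1 - 1/(1 + t))^2 / 3.\<close>
    have "mu x = - 1 / 3 + (2 / 3) / (1 + x $ 3) ^ 1 + (- 1 / 3) / (1 + x $ 3) ^ 2"
      if "x \<in> hyp3" for x
    proof -
      have "1 + x $ 3 \<noteq> 0" using that by (simp add: hyp3_def)
      then show ?thesis by (simp add: mu_def divide_simps) (simp add: algebra_simps power2_eq_square)
    qed
    then show ?thesis
      using Ck_on_height_rational[of 1 k "- 1 / 3" "2 / 3" 1 "- 1 / 3" 2]
      by (subst Ck_on_cong[OF open_hyp3]) auto
  qed
  moreover have "ricci hyp3_metric x + hessian hyp3_metric f x
        - mu x *\<^sub>R tensor_product (differential f x) (differential f x)
      = lam x *\<^sub>R hyp3_metric x" if x: "x \<in> hyp3" for x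
  proof -
    define t where "t = x $ 3"
    have t: "t > 0" using x by (simp add: hyp3_def t_def)
    have df: "differential f x $ j = (if j = 3 then \<phi>' t else 0)" for j
      using partial_deriv_height[OF \<phi>] t by (simp add: differential_def f_def [abs_def] t_def)
    have h: "hessian hyp3_metric f x =
      (\<chi> i j. (if i = 3 \<and> j = 3 then \<phi>'' t + 2 * \<phi>' t / t else 0) - (if i = j then \<phi>' t / t else 0))"
      unfolding f_def [abs_def] t_def by (rule hessian_height[OF \<phi> \<phi>' x])
    \<comment> \<open>This is the coefficient of the identity matrix on both sides; it determines
      \<open>lam\<close>.\<close>
    have horizontal: "- 2 / t\<^sup>2 - \<phi>' t / t = (1 + 3 / t) / t\<^sup>2"
      using t by (simp add: \<phi>'_def field_simps power2_eq_square)
    have "\<phi>' t = - 3 * (1 + t) / t\<^sup>2"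
      using t by (simp add: \<phi>'_def field_simps power2_eq_square)
    then have "- t\<^sup>2 / (3 * (1 + t)\<^sup>2) * (\<phi>' t * \<phi>' t) = - 3 / t\<^sup>2"
      using t by (simp only:) (simp add: divide_simps power2_eq_square, simp add: algebra_simps)
    moreover have "\<phi>'' t + 2 * \<phi>' t / t = - 3 / t\<^sup>2"
      using t by (simp add: \<phi>'_def \<phi>''_def field_simps power2_eq_square power3_eq_cube)
    \<comment> \<open>This is the remaining dt^2 coefficient; it determines \<open>mu\<close>, and
      both sides equal -3/t^2.\<close>
    ultimately have vertical: "\<phi>'' t + 2 * \<phi>' t / t = - t\<^sup>2 / (3 * (1 + t)\<^sup>2) * (\<phi>' t * \<phi>' t)"
      by simp
    show ?thesis
      unfolding ricci_hyp3[OF x] h vec_eq_iff forall_3 lam_def mu_def t_def[symmetric]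
        tensor_product_def
      using horizontal vertical by (simp add: hyp3_metric_component df t_def[symmetric])
  qed
  moreover have "lam x > 0" if "x \<in> hyp3" for x
    using that by (simp add: lam_def hyp3_def add_pos_pos)
  moreover have "\<not> mu constant_on hyp3"
  proof
    assume "mu constant_on hyp3"
    moreover have "vec 1 \<in> hyp3" "vec 2 \<in> hyp3"
      by (simp_all add: hyp3_def)
    ultimately have "mu (vec 1) = mu (vec 2)"
      unfolding constant_on_def by metis
    \<comment> \<open>The two values are -1/12 and -4/27.\<close>
    then show False by (simp add: mu_def)
  qed
  ultimately show ?thesis
    unfolding smooth_on_def by blast
qed

end
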